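(* Let $f(\mu,p)=0$ be an equation of state with $f$ analytic at the central values $(\mu_c,p_c)=(\mu(0),p(0))$ and $\partial_\mu f(\mu_c,p_c)\neq0$, and let $\mu(r),p(r)$ be real analytic at $r=0$ and solve the Tolman--Oppenheimer--Volkoff (TOV) equations together with $f(\mu(r),p(r))=0$. Then, with subscripts on $f$ denoting partial derivatives evaluated at $(\mu_c,p_c)$, $$\begin{aligned}\mu(r)&=\mu_c+\frac{(\mu_c+p_c)(\mu_c+3p_c)f_p}{12f_\mu}r^2+\frac{\mu_c^2+3p_c^2+4\mu_cp_c}{48f_\mu}\Big[\frac{(4\mu_c+9p_c)(f_p)^2}{15f_\mu}-\frac{(\mu_c+p_c)(\mu_c+3p_c)f_{pp}}{6}\\&\quad+\frac{(\mu_c+p_c)(\mu_c+3p_c)f_pf_{\mu p}}{3f_\mu}-\frac{(\mu_c+p_c)(\mu_c+3p_c)(f_p)^2f_{\mu\mu}}{6(f_\mu)^2}-p_cf_p\Big]r^4+\mathcal{O}(r^6),\\ p(r)&=p_c-\frac{(\mu_c+p_c)(\mu_c+3p_c)}{12}r^2-\frac{(\mu_c+p_c)(\mu_c+3p_c)\left[(4\mu_c+9p_c)f_p-15p_cf_\mu\right]}{720f_\mu}r^4+\mathcal{O}(r^6),\\ \mathcal{A}(r)&=\frac{\mu_c+3p_c}{6}r+\frac{(\mu_c+3p_c)\left[3(\mu_c+p_c)f_p-5(\mu_c+3p_c)f_\mu\right]}{360f_\mu}r^3+\mathcal{O}(r^5).\end{aligned}$$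
   Context: Units $8\pi G=c=1$, cosmological constant $\Lambda=0$. The TOV equations for functions $\mu(r)$ (energy density) and $p(r)$ (pressure) of the circumferential radius $r$ are $$\frac{dp}{dr}=-\frac{r^{2}(\mu+p)}{2(r-2M)}\left(p+\frac{2M}{r^{3}}\right),\qquad \frac{dM}{dr}=\frac12\mu r^{2},\qquad M(r)=\frac12\int_0^r\mu(x)x^2\,dx ,$$ and only regular solutions with $r>2M(r)$ for $r>0$ are considered. The potentials $\phi$ and $\mathcal{A}$ are defined by $\phi=\frac{2}{r}\sqrt{1-\frac{2M}{r}}$ and $\mathcal{A}\,\phi=p+\frac{2M}{r^{3}}$. *)

theory Defs
  imports "HOL-Analysis.Analysis" "HOL-Library.Landau_Symbols"
begin

(* The circumferential radius r ranges over [0, \<infinity>), so the centre r = 0 is an endpoint of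
   the domain; analyticity at a is therefore taken relative to a set S.  For S = UNIV this
   is analyticity on a neighbourhood of a. *)
definition real_analytic_at_within :: "(real \<Rightarrow> real) \<Rightarrow> real \<Rightarrow> real set \<Rightarrow> bool" where
  "real_analytic_at_within g a S \<longleftrightarrow>
     (\<exists>c e. e > 0 \<and> (\<forall>x\<in>S. \<bar>x - a\<bar> < e \<longrightarrow> (\<lambda>n::nat. c n * (x - a) ^ n) sums g x))"

definition real_analytic2_at :: "(real \<Rightarrow> real \<Rightarrow> real) \<Rightarrow> real \<Rightarrow> real \<Rightarrow> bool" where
  "real_analytic2_at f a b \<longleftrightarrow>
     (\<exists>c e. e > 0 \<and>
        (\<forall>x y. \<bar>x - a\<bar> < e \<and> \<bar>y - b\<bar> < e \<longrightarrow>
           ((\<lambda>(i::nat, j::nat). c i j * (x - a) ^ i * (y - b) ^ j) has_sum f x y) UNIV))"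

definition partial1 :: "(real \<Rightarrow> real \<Rightarrow> real) \<Rightarrow> real \<Rightarrow> real \<Rightarrow> real" where
  "partial1 f x y = deriv (\<lambda>t. f t y) x"

definition partial2 :: "(real \<Rightarrow> real \<Rightarrow> real) \<Rightarrow> real \<Rightarrow> real \<Rightarrow> real" where
  "partial2 f x y = deriv (\<lambda>t. f x t) y"

definition tov_mass :: "(real \<Rightarrow> real) \<Rightarrow> real \<Rightarrow> real" where
  "tov_mass \<mu> r = 1/2 * integral {0..r} (\<lambda>x. \<mu> x * x\<^sup>2)"

(* Integrability is required explicitly because the integral of a non-integrable function
   is 0 by convention.  R may be any radius up to which the solution exists. *)
definition tov_solution :: "(real \<Rightarrow> real) \<Rightarrow> (real \<Rightarrow> real) \<Rightarrow> real \<Rightarrow> bool" where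
  "tov_solution \<mu> p R \<longleftrightarrow> 0 < R \<and>
     (\<forall>r. 0 < r \<and> r < R \<longrightarrow>
        (\<lambda>x. \<mu> x * x\<^sup>2) integrable_on {0..r} \<and>
        r > 2 * tov_mass \<mu> r \<and>
        (p has_real_derivative
           - (r\<^sup>2 * (\<mu> r + p r)) / (2 * (r - 2 * tov_mass \<mu> r)) * (p r + 2 * tov_mass \<mu> r / r ^ 3))
          (at r) \<and>
        (tov_mass \<mu> has_real_derivative 1/2 * \<mu> r * r\<^sup>2) (at r))"

definition tov_phi :: "(real \<Rightarrow> real) \<Rightarrow> real \<Rightarrow> real" where
  "tov_phi \<mu> r = 2 / r * sqrt (1 - 2 * tov_mass \<mu> r / r)"

(* The solution A of A * phi = p + 2 M / r^3; phi r > 0 whenever r > 0 and r > 2 M(r). *)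
definition tov_A :: "(real \<Rightarrow> real) \<Rightarrow> (real \<Rightarrow> real) \<Rightarrow> real \<Rightarrow> real" where
  "tov_A \<mu> p r = (p r + 2 * tov_mass \<mu> r / r ^ 3) / tov_phi \<mu> r"

end

(* Near the centre mu, p and 2 M(r) / r^3 are convergent power series on r >= 0, and the TOV equation
   becomes an identity of power series.  Its lowest coefficient gives p_1 = 0; the linear part of the
   equation of state then gives mu_1 = 0, so the deviations from the central values are O(r^2) and
   the cubic Taylor remainder of f is O(r^6).  Hence the second-order Taylor polynomial of f determines
   mu_2, ..., mu_5 from p_2, ..., p_5, and the TOV recursion supplies the latter alternately.  All odd
   coefficients up to order 5 vanish, which is what makes the error terms O(r^6) and O(r^5). *)
theory Submission
  imports Defs
begin

section \<open>Power series at the origin and one-sided asymptotics\<close>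

text \<open>Dividing a series by \<open>fps_X ^ N\<close> keeps its radius of convergence positive,
  so the quotient is again the value of a convergent series. Orders of vanishing can thus be read
  off from finitely many coefficients, and the leading coefficient is recovered as a limit.\<close>

lemma has_fps_expansion_factor:
  fixes h :: "real \<Rightarrow> real"
  assumes h: "h has_fps_expansion H" and H: "\<And>n. n < N \<Longrightarrow> fps_nth H n = 0"
  shows "\<forall>\<^sub>F r in nhds 0. h r = r ^ N * eval_fps (fps_shift N H) r"
    and "eval_fps (fps_shift N H) has_fps_expansion fps_shift N H"
proof -
  have rad: "fps_conv_radius H > 0" and ev: "\<forall>\<^sub>F z in nhds 0. eval_fps H z = h z"
    using h by (auto simp: has_fps_expansion_def)
  show *: "eval_fps (fps_shift N H) has_fps_expansion fps_shift N H"
    using rad by (intro eval_fps_has_fps_expansion) simp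
  have "fps_X ^ N * fps_shift N H = H"
    using H by (intro fps_ext) (auto simp: fps_X_power_mult_nth)
  moreover have "(\<lambda>r. r ^ N * eval_fps (fps_shift N H) r) has_fps_expansion fps_X ^ N * fps_shift N H"
    by (intro has_fps_expansion_mult * has_fps_expansion_fps_X_power)
  ultimately have "\<forall>\<^sub>F z in nhds 0. eval_fps H z = z ^ N * eval_fps (fps_shift N H) z"
    by (simp add: has_fps_expansion_def)
  with ev show "\<forall>\<^sub>F r in nhds 0. h r = r ^ N * eval_fps (fps_shift N H) r"
    by eventually_elim simp
qed

lemma has_fps_expansion_tendsto:
  fixes h :: "real \<Rightarrow> real"
  assumes "h has_fps_expansion H"
  shows "(h \<longlongrightarrow> fps_nth H 0) (at_right 0)"
proof -
  have "h 0 = fps_nth H 0"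
    using assms by (auto simp: has_fps_expansion_def eval_fps_at_0 dest: eventually_nhds_x_imp_x)
  then show ?thesis
    using has_fps_expansion_imp_continuous[OF assms, of "{0<..}"] by (simp add: continuous_within)
qed

lemma fps_expansion_imp_bigo:
  fixes h :: "real \<Rightarrow> real"
  assumes h: "h has_fps_expansion H" and H: "\<And>n. n < N \<Longrightarrow> fps_nth H n = 0"
  shows "h \<in> O[at_right 0](\<lambda>r. r ^ N)"
proof -
  let ?g = "eval_fps (fps_shift N H)"
  note fac = has_fps_expansion_factor[OF h H]
  have "(?g \<longlongrightarrow> fps_nth (fps_shift N H) 0) (at_right 0)"
    by (intro has_fps_expansion_tendsto fac)
  then have "?g \<in> O[at_right 0](\<lambda>_. 1)"
    by (intro bigoI_tendsto[where c = "fps_nth H N"]) simp_all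
  then have "(\<lambda>r. r ^ N * ?g r) \<in> O[at_right 0](\<lambda>r. r ^ N * 1)"
    by (intro landau_o.big.mult) auto
  moreover have "\<forall>\<^sub>F r in at_right 0. h r = r ^ N * ?g r"
    by (rule filter_leD[OF at_within_le_nhds fac(1)])
  ultimately show ?thesis
    by (subst landau_o.big.in_cong) simp_all
qed

lemma fps_expansion_taylor_bigo:
  fixes h :: "real \<Rightarrow> real"
  assumes "h has_fps_expansion H"
  shows "(\<lambda>r. h r - (\<Sum>n<N. fps_nth H n * r ^ n)) \<in> O[at_right 0](\<lambda>r. r ^ N)"
proof (rule fps_expansion_imp_bigo)
  show "(\<lambda>r. h r - (\<Sum>n<N. fps_nth H n * r ^ n)) has_fps_expansion
      H - (\<Sum>n<N. fps_const (fps_nth H n) * fps_X ^ n)"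
    by (intro has_fps_expansion_diff has_fps_expansion_sum has_fps_expansion_cmult_left
        has_fps_expansion_fps_X_power assms)
  show "fps_nth (H - (\<Sum>n<N. fps_const (fps_nth H n) * fps_X ^ n)) n = 0" if "n < N" for n
    using that by (simp add: fps_sum_nth if_distrib cong: if_cong)
qed

lemma bigo_power_mono:
  assumes "m \<le> n"
  shows "(\<lambda>r. r ^ n) \<in> O[at_right 0](\<lambda>r::real. r ^ m)"
proof (rule bigoI[where c = 1])
  have "\<forall>\<^sub>F r in at_right (0::real). r \<in> {0<..<1}"
    by (rule eventually_at_right_real) simp
  then show "\<forall>\<^sub>F r in at_right (0::real). norm (r ^ n) \<le> 1 * norm (r ^ m)"
    by eventually_elim (use assms in \<open>auto intro: power_decreasing\<close>)
qed

text \<open>A bound known only for r > 0 still determines coefficients. By induction those below N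
  vanish; after r^N is divided out the cofactor is O(r), so its limit from the right, which is
  coefficient N, is zero. Both the TOV equation and the equation of state are turned into
  coefficient relations in this way.\<close>

lemma bigo_imp_fps_nth_eq_0:
  fixes h :: "real \<Rightarrow> real"
  assumes h: "h has_fps_expansion H" and "h \<in> O[at_right 0](\<lambda>r. r ^ N)" "n < N"
  shows "fps_nth H n = 0"
  using assms(2,3)
proof (induction N arbitrary: n)
  case (Suc N)
  let ?g = "eval_fps (fps_shift N H)"
  have hN: "h \<in> O[at_right 0](\<lambda>r. r ^ N)"
    by (rule landau_o.big_trans[OF Suc.prems(1) bigo_power_mono]) simp
  have low: "fps_nth H k = 0" if "k < N" for k
    by (rule Suc.IH[OF hN that])
  note fac = has_fps_expansion_factor[OF h low]
  have ev: "\<forall>\<^sub>F r in at_right 0. h r = r ^ N * ?g r"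
    by (rule filter_leD[OF at_within_le_nhds fac(1)])
  have "(\<lambda>r. r ^ N * ?g r) \<in> O[at_right 0](\<lambda>r. r ^ N * r)"
    using Suc.prems(1) unfolding landau_o.big.in_cong[OF ev] power_Suc2 .
  moreover have nz: "\<forall>\<^sub>F r::real in at_right 0. r ^ N \<noteq> 0"
    by (rule eventually_mono[OF eventually_at_right_less]) simp
  ultimately have "?g \<in> O[at_right 0](\<lambda>r. r)"
    by (simp only: landau_o.big.mult_cancel_left[OF bigtheta_refl nz])
  moreover have "(\<lambda>r::real. r) \<in> o[at_right 0](\<lambda>_. 1)"
    using tendsto_ident_at[of "0::real" "{0<..}"] by (intro smalloI_tendsto) simp_all
  ultimately have "?g \<in> o[at_right 0](\<lambda>_. 1)"
    by (rule landau_o.big_small_trans)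
  then have 0: "(?g \<longlongrightarrow> 0) (at_right 0)"
    using smalloD_tendsto[of ?g "at_right 0" "\<lambda>_. 1"] by simp
  have "fps_nth (fps_shift N H) 0 = 0"
    by (rule tendsto_unique[OF trivial_limit_at_right_real has_fps_expansion_tendsto[OF fac(2)] 0])
  then have "fps_nth H N = 0" by simp
  moreover have "n < N \<or> n = N" using Suc.prems(2) by auto
  ultimately show ?case using low by blast
qed (simp only: not_less0)

section \<open>Analytic profiles on r >= 0, the mass function, and the inverse square root\<close>

text \<open>Analyticity relative to \<open>{0..}\<close> constrains only r >= 0, but convergence at
  the single point e/2 already forces convergence for all arguments of absolute value below e/2. So
  \<open>eval_fps G\<close> is a two-sided analytic extension, and the values of \<open>g\<close> at
  negative arguments never enter.\<close>

lemma real_analytic_at_within_0_fps: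
  assumes "real_analytic_at_within g 0 {0..}"
  obtains G e where "e > 0" "ereal e \<le> fps_conv_radius G" "\<And>r. 0 \<le> r \<Longrightarrow> r < e \<Longrightarrow> eval_fps G r = g r"
proof -
  obtain c e where e: "e > 0" and s: "\<And>x. 0 \<le> x \<Longrightarrow> x < e \<Longrightarrow> (\<lambda>n::nat. c n * x ^ n) sums g x"
    using assms by (auto simp: real_analytic_at_within_def)
  show thesis
  proof
    show "e/2 > 0" using e by simp
    have "conv_radius c \<ge> norm (e/2)"
      using s[of "e/2"] e by (intro conv_radius_geI) (auto simp: sums_iff)
    then show "ereal (e/2) \<le> fps_conv_radius (Abs_fps c)"
      using e by (simp add: fps_conv_radius_def)
    show "eval_fps (Abs_fps c) r = g r" if "0 \<le> r" "r < e/2" for r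
      using s[of r] that e by (simp add: eval_fps_def sums_iff)
  qed
qed

text \<open>If \<open>F\<close> is the series of \<open>\<mu>\<close>, this is the series of \<open>2 M(r) / r\<^sup>3\<close>.\<close>
definition fps_mean :: "real fps \<Rightarrow> real fps" where
  "fps_mean F = Abs_fps (\<lambda>n. fps_nth F n / real (n + 3))"

lemma fps_conv_radius_mean: "fps_conv_radius F \<le> fps_conv_radius (fps_mean F)"
  unfolding fps_conv_radius_def
proof (rule conv_radius_geI_ex)
  fix r :: real assume r: "0 < r" "ereal r < conv_radius (fps_nth F)"
  then have "summable (\<lambda>n. norm (fps_nth F n * r ^ n))"
    by (intro norm_summable_fps) (simp add: fps_conv_radius_def)
  then have "summable (\<lambda>n. fps_nth (fps_mean F) n * r ^ n)"
    by (rule summable_comparison_test[rotated])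
       (auto simp: fps_mean_def abs_mult divide_simps mult_le_cancel_left1 not_less intro!: exI[of _ 0])
  then show "\<exists>z. norm z = r \<and> summable (\<lambda>n. fps_nth (fps_mean F) n * z ^ n)"
    using r by (intro exI[of _ r]) simp
qed

text \<open>The factor n + 3 from differentiating r^(n+3) cancels the denominator in
  \<open>fps_mean\<close>, so r^3 times the mean series is an antiderivative of \<mu>(r) r^2 that
  vanishes at 0.\<close>

lemma tov_mass_eq_eval_fps:
  assumes e: "ereal e \<le> fps_conv_radius F"
    and F: "\<And>r. 0 \<le> r \<Longrightarrow> r < e \<Longrightarrow> eval_fps F r = \<mu> r"
    and r: "0 \<le> r" "r < e"
  shows "2 * tov_mass \<mu> r = r ^ 3 * eval_fps (fps_mean F) r"
proof -
  let ?P = "fps_X ^ 3 * fps_mean F"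
  have rad: "ereal \<bar>x\<bar> < fps_conv_radius F" "ereal \<bar>x\<bar> < fps_conv_radius (fps_mean F)"
    "ereal \<bar>x\<bar> < fps_conv_radius ?P" if "0 \<le> x" "x \<le> r" for x
  proof -
    show 1: "ereal \<bar>x\<bar> < fps_conv_radius F"
      using that r by (intro less_le_trans[OF _ e]) simp
    then show 2: "ereal \<bar>x\<bar> < fps_conv_radius (fps_mean F)"
      using fps_conv_radius_mean less_le_trans by blast
    show "ereal \<bar>x\<bar> < fps_conv_radius ?P"
      using 2 fps_conv_radius_mult[of "fps_X ^ 3" "fps_mean F"] by (simp add: less_le_trans)
  qed
  have "fps_nth (fps_deriv ?P) n = fps_nth (fps_X ^ 2 * F) n" for n
  proof (cases "n < 2")
    case False
    then obtain k where "n = k + 2" by (metis add.commute le_Suc_ex linorder_not_less)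
    then show ?thesis
      unfolding fps_deriv_nth fps_X_power_mult_nth by (simp add: fps_mean_def field_simps)
  qed (simp add: fps_X_power_mult_nth del: fps_deriv_mult)
  then have "fps_deriv ?P = fps_X ^ 2 * F" by (rule fps_ext)
  then have "(eval_fps ?P has_vector_derivative \<mu> x * x\<^sup>2) (at x within {0..r})" if "x \<in> {0..r}" for x
    using has_field_derivative_eval_fps[of x ?P "{0..r}"] rad[of x] that r F[of x]
    by (simp add: eval_fps_mult has_real_derivative_iff_has_vector_derivative mult.commute)
  then have "((\<lambda>x. \<mu> x * x\<^sup>2) has_integral eval_fps ?P r - eval_fps ?P 0) {0..r}"
    using r by (intro fundamental_theorem_of_calculus) auto
  then show ?thesis
    using rad[of r] r by (simp add: tov_mass_def integral_unique eval_fps_at_0 eval_fps_mult)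
qed

text \<open>In terms of y = sqrt (1 - u), both the error and u^2 contain the exact factor (1 - y)^2,
  and the remaining quotient is bounded for y >= 1/2, which the range 3/4 guarantees. With u = 2M/r
  this takes the place of a series for the square root when dividing by
  \<open>tov_phi\<close>.\<close>

lemma inverse_sqrt_remainder:
  assumes "\<bar>u\<bar> \<le> 3/4"
  shows "\<bar>1 / sqrt (1 - u) - (1 + u/2)\<bar> \<le> 4 * u\<^sup>2"
proof -
  define y where "y = sqrt (1 - u)"
  have "sqrt (1/4) \<le> y"
    unfolding y_def using assms by (intro real_sqrt_le_mono) auto
  then have y: "y \<ge> 1/2" "y\<^sup>2 = 1 - u"
    using assms by (auto simp: y_def real_sqrt_divide)
  have u: "u = 1 - y\<^sup>2" using y by simp
  have "1 / y - (1 + u/2) = (1 - y)\<^sup>2 * ((2 + y) / (2 * y))"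
    unfolding u using y by (simp add: field_simps power2_eq_square)
  moreover have "u\<^sup>2 = (1 - y)\<^sup>2 * (1 + y)\<^sup>2"
    unfolding u by (simp add: power2_eq_square algebra_simps)
  moreover have "(2 + y) / (2 * y) \<le> 4 * (1 + y)\<^sup>2"
  proof -
    have "4 * (1 + y)\<^sup>2 = 4 + 8 * y + 4 * y\<^sup>2" by (simp add: power2_eq_square algebra_simps)
    then have "2 + y \<le> 4 * (1 + y)\<^sup>2 * 1" using y(1) zero_le_power2[of y] by linarith
    also have "\<dots> \<le> 4 * (1 + y)\<^sup>2 * (2 * y)" using y by (intro mult_left_mono) auto
    finally show ?thesis using y by (simp add: field_simps)
  qed
  then have "(1 - y)\<^sup>2 * ((2 + y) / (2 * y)) \<le> (1 - y)\<^sup>2 * (4 * (1 + y)\<^sup>2)"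
    by (intro mult_left_mono) auto
  moreover have "0 \<le> (1 - y)\<^sup>2 * ((2 + y) / (2 * y))" using y by auto
  ultimately show ?thesis
    unfolding y_def[symmetric] by (simp add: mult_ac)
qed

section \<open>Convergent double series: partial derivatives and Taylor remainder\<close>

lemma sums_power_series_deriv:
  fixes g :: "real \<Rightarrow> real"
  assumes g: "\<And>x. \<bar>x - a\<bar> < e \<Longrightarrow> (\<lambda>n. c n * (x - a) ^ n) sums g x" and x: "\<bar>x - a\<bar> < e"
  shows "(\<lambda>n. diffs c n * (x - a) ^ n) sums deriv g x"
proof -
  have summable: "summable (\<lambda>n. c n * z ^ n)" if "norm z < e" for z :: real
    using g[of "z + a"] that by (auto simp: sums_iff)
  have "((\<lambda>z. \<Sum>n. c n * z ^ n) has_field_derivative (\<Sum>n. diffs c n * (x - a) ^ n)) (at (x - a))"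
    by (rule termdiffs_strong'[OF summable]) (use x in auto)
  then have "((\<lambda>x. \<Sum>n. c n * (x - a) ^ n) has_field_derivative (\<Sum>n. diffs c n * (x - a) ^ n)) (at x)"
    using DERIV_shift[of "\<lambda>z. \<Sum>n. c n * z ^ n" _ x "- a"] by simp
  then have "(g has_field_derivative (\<Sum>n. diffs c n * (x - a) ^ n)) (at x)"
  proof (rule has_field_derivative_transform_within_open)
    show "open (ball a e)" "x \<in> ball a e" using x by (auto simp: dist_real_def)
    show "(\<Sum>n. c n * (y - a) ^ n) = g y" if "y \<in> ball a e" for y
      using g[of y] that by (auto simp: sums_iff dist_real_def)
  qed
  moreover have "summable (\<lambda>n. diffs c n * (x - a) ^ n)"
    by (rule termdiff_converges[OF _ summable]) (use x in auto)
  ultimately show ?thesis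
    by (simp add: DERIV_imp_deriv summable_sums)
qed

lemma sums_power_series_center:
  fixes g :: "real \<Rightarrow> real"
  assumes "(\<lambda>n. c n * (a - a) ^ n) sums g a"
  shows "g a = c 0"
  using assms powser_sums_zero[of c] by (simp add: sums_unique2)

lemma deriv_power_series_center:
  fixes g :: "real \<Rightarrow> real"
  assumes "e > 0" and g: "\<And>x. \<bar>x - a\<bar> < e \<Longrightarrow> (\<lambda>n. c n * (x - a) ^ n) sums g x"
  shows "deriv g a = c 1"
  using sums_power_series_center[of "diffs c" a "deriv g"] sums_power_series_deriv[OF g, of e a] assms(1)
  by (simp add: diffs_def)

context
  fixes f :: "real \<Rightarrow> real \<Rightarrow> real" and c :: "nat \<Rightarrow> nat \<Rightarrow> real" and a b e :: real
  assumes e: "e > 0"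
    and f: "\<And>x y. \<bar>x - a\<bar> < e \<Longrightarrow> \<bar>y - b\<bar> < e \<Longrightarrow>
      ((\<lambda>(i, j). c i j * (x - a) ^ i * (y - b) ^ j) has_sum f x y) UNIV"
begin

text \<open>Grouping the double series by powers of x - a turns it into an ordinary power series in
  x whose coefficients depend on y; partial derivatives at the centre then reduce to termwise
  differentiation in one variable.\<close>

private definition row :: "nat \<Rightarrow> real \<Rightarrow> real" where
  "row i y = (\<Sum>\<^sub>\<infinity>j. c i j * (y - b) ^ j)"

text \<open>At x = a + e/2 each row is a subfamily of a summable family, and the nonzero factor
  (e/2)^i can be divided out. The choice x = a would see only the row i = 0.\<close>

private lemma row_has_sum:
  assumes "\<bar>y - b\<bar> < e"
  shows "((\<lambda>j. c i j * (y - b) ^ j) has_sum row i y) UNIV"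
proof -
  have "(\<lambda>(i, j). c i j * (e/2) ^ i * (y - b) ^ j) summable_on UNIV \<times> UNIV"
    using f[of "a + e/2" y] e assms by (auto simp: summable_on_def)
  then have "(\<lambda>j. c i j * (e/2) ^ i * (y - b) ^ j) summable_on UNIV"
    by (rule summable_on_SigmaD1) simp
  then have "(\<lambda>j. (e/2) ^ i * (c i j * (y - b) ^ j)) summable_on UNIV"
    by (simp add: mult_ac)
  then have "(\<lambda>j. c i j * (y - b) ^ j) summable_on UNIV"
    by (subst (asm) summable_on_cmult_right') (use e in auto)
  then show ?thesis
    unfolding row_def by (rule has_sum_infsum)
qed

private lemma row_center: "row i b = c i 0"
  using sums_power_series_center[of "c i" b "row i"] has_sum_imp_sums[OF row_has_sum[of b i]] e
  by simp

private lemma sums_rows: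
  assumes "\<bar>x - a\<bar> < e" "\<bar>y - b\<bar> < e"
  shows "(\<lambda>i. row i y * (x - a) ^ i) sums f x y"
proof (rule has_sum_imp_sums, rule has_sum_SigmaD)
  show "((\<lambda>(i, j). c i j * (x - a) ^ i * (y - b) ^ j) has_sum f x y) (UNIV \<times> UNIV)"
    using f assms by simp
  show "((\<lambda>j. case (i, j) of (i, j) \<Rightarrow> c i j * (x - a) ^ i * (y - b) ^ j) has_sum row i y * (x - a) ^ i) UNIV" for i
    using has_sum_cmult_left[OF row_has_sum[OF assms(2), of i], of "(x - a) ^ i"]
    by (simp add: mult_ac)
qed

lemma power_series2_center: "f a b = c 0 0"
  using sums_power_series_center[of "\<lambda>i. row i b" a "\<lambda>x. f x b"] sums_rows[of a b] e
  by (simp add: row_center)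

private lemma sums_partial1:
  assumes "\<bar>x - a\<bar> < e" "\<bar>y - b\<bar> < e"
  shows "(\<lambda>i. diffs (\<lambda>i. row i y) i * (x - a) ^ i) sums partial1 f x y"
  unfolding partial1_def by (rule sums_power_series_deriv[OF sums_rows]) (use assms in auto)

private lemma partial1_row: "\<bar>y - b\<bar> < e \<Longrightarrow> partial1 f a y = row 1 y"
  using sums_power_series_center[of _ a "\<lambda>x. partial1 f x y"] sums_partial1[of a y] e
  by (simp add: diffs_def)

text \<open>On the line x = a all rows except \<open>row 0\<close> drop out, so f there is the
  series in y with coefficients \<open>c 0\<close>.\<close>

private lemma sums_partial2:
  assumes "\<bar>y - b\<bar> < e"
  shows "(\<lambda>j. diffs (c 0) j * (y - b) ^ j) sums partial2 f a y"
  unfolding partial2_def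
proof (rule sums_power_series_deriv[OF _ assms])
  show "(\<lambda>j. c 0 j * (t - b) ^ j) sums f a t" if "\<bar>t - b\<bar> < e" for t
    using sums_power_series_center[of "\<lambda>i. row i t" a "\<lambda>x. f x t"] sums_rows[of a t] e that
      has_sum_imp_sums[OF row_has_sum[OF that, of 0]]
    by simp
qed

text \<open>On the line x = a, \<open>partial1 f\<close> is \<open>row 1\<close>, whose own series
  in y gives the mixed derivative. The factor 2 is the one that \<open>diffs\<close> puts on the
  coefficient of index 2.\<close>

lemma power_series2_partials:
  "partial1 f a b = c 1 0" "partial2 f a b = c 0 1"
  "partial1 (partial1 f) a b = 2 * c 2 0" "partial2 (partial1 f) a b = c 1 1"
  "partial2 (partial2 f) a b = 2 * c 0 2"
proof -
  show "partial1 f a b = c 1 0"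
    using partial1_row[of b] e by (simp add: row_center)
  show "partial2 f a b = c 0 1"
    using sums_power_series_center[of _ b "partial2 f a"] sums_partial2[of b] e
    by (simp add: diffs_def)
  show "partial1 (partial1 f) a b = 2 * c 2 0"
    using deriv_power_series_center[OF e sums_partial1, of b] e
    by (simp add: partial1_def[of "partial1 f"] diffs_def row_center numeral_2_eq_2)
  have "(\<lambda>j. c 1 j * (y - b) ^ j) sums partial1 f a y" if "\<bar>y - b\<bar> < e" for y
    using has_sum_imp_sums[OF row_has_sum[OF that, of 1]] partial1_row that by simp
  then show "partial2 (partial1 f) a b = c 1 1"
    using deriv_power_series_center[OF e] by (simp add: partial2_def[of "partial1 f"])
  show "partial2 (partial2 f) a b = 2 * c 0 2"
    using deriv_power_series_center[OF e sums_partial2]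
    by (simp add: partial2_def[of "partial2 f"] diffs_def numeral_2_eq_2)
qed

text \<open>Majorant argument: at the corner (a + d, b + d) the terms are absolutely summable, and
  every omitted term has total degree at least N. With t the maximum distance from the centre, its
  absolute value is thus at most that of the corner term times (t/d)^N.\<close>

lemma power_series2_remainder:
  obtains C where "\<And>x y. \<bar>x - a\<bar> \<le> e/2 \<Longrightarrow> \<bar>y - b\<bar> \<le> e/2 \<Longrightarrow>
    \<bar>f x y - (\<Sum>i<N. \<Sum>j<N - i. c i j * (x - a) ^ i * (y - b) ^ j)\<bar>
      \<le> C * max \<bar>x - a\<bar> \<bar>y - b\<bar> ^ N"
proof
  define d where "d = e/2"
  define T where "T = Sigma {..<N} (\<lambda>i. {..<N - i})"
  define G where "G = (\<lambda>(i, j). \<bar>c i j\<bar> * d ^ (i + j))"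
  have d: "0 < d" "d < e" using e by (auto simp: d_def)
  \<comment> \<open>For real families unordered summability is absolute summability; d = e/2 keeps
    the corner strictly inside the region of convergence.\<close>
  have "(\<lambda>p. norm (case p of (i, j) \<Rightarrow> c i j * d ^ i * d ^ j)) summable_on UNIV"
    using f[of "a + d" "b + d"] d
    by (subst summable_on_iff_abs_summable_on_real[symmetric]) (auto simp: summable_on_def)
  also have "(\<lambda>p. norm (case p of (i, j) \<Rightarrow> c i j * d ^ i * d ^ j)) = G"
    using d by (auto simp: G_def abs_mult power_add)
  finally have "G summable_on (UNIV - T)"
    by (rule summable_on_subset_banach) simp
  then have G: "(G has_sum infsum G (UNIV - T)) (UNIV - T)"
    by (rule has_sum_infsum)
  fix x y :: real
  assume xy: "\<bar>x - a\<bar> \<le> e/2" "\<bar>y - b\<bar> \<le> e/2"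
  define t where "t = max \<bar>x - a\<bar> \<bar>y - b\<bar>"
  have t: "0 \<le> t" "t \<le> d" "\<bar>x - a\<bar> \<le> t" "\<bar>y - b\<bar> \<le> t" using xy by (auto simp: t_def d_def)
  let ?F = "\<lambda>(i, j). c i j * (x - a) ^ i * (y - b) ^ j"
  have "(?F has_sum (f x y - sum ?F T)) (UNIV - T)"
    using xy e by (intro has_sum_Diff f has_sum_finite) (auto simp: T_def)
  moreover have "((\<lambda>p. G p * (t/d) ^ N) has_sum infsum G (UNIV - T) * (t/d) ^ N) (UNIV - T)"
    by (rule has_sum_cmult_left[OF G])
  ultimately have "norm (f x y - sum ?F T) \<le> infsum G (UNIV - T) * (t/d) ^ N"
  proof (rule norm_infsum_le)
    fix p assume p: "p \<in> UNIV - T"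
    obtain i j where ij: "p = (i, j)" by (cases p)
    have N: "N \<le> i + j" using p by (auto simp: ij T_def)
    have "\<bar>x - a\<bar> ^ i * \<bar>y - b\<bar> ^ j \<le> t ^ i * t ^ j"
      using t by (intro mult_mono power_mono) auto
    also have "\<dots> = d ^ (i + j) * (t/d) ^ (i + j)"
      using d by (simp add: power_add power_divide)
    \<comment> \<open>As t/d <= 1, the powers of t/d beyond N can only decrease the product.\<close>
    also have "\<dots> \<le> d ^ (i + j) * (t/d) ^ N"
      using d t N by (intro mult_left_mono power_decreasing) auto
    finally have "\<bar>c i j\<bar> * (\<bar>x - a\<bar> ^ i * \<bar>y - b\<bar> ^ j) \<le> \<bar>c i j\<bar> * (d ^ (i + j) * (t/d) ^ N)"
      by (rule mult_left_mono) simp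
    then show "norm (?F p) \<le> G p * (t/d) ^ N"
      by (simp add: ij G_def abs_mult power_abs mult_ac)
  qed
  moreover have "sum ?F T = (\<Sum>i<N. \<Sum>j<N - i. c i j * (x - a) ^ i * (y - b) ^ j)"
    unfolding T_def by (subst sum.Sigma) auto
  ultimately show "\<bar>f x y - (\<Sum>i<N. \<Sum>j<N - i. c i j * (x - a) ^ i * (y - b) ^ j)\<bar>
      \<le> infsum G (UNIV - T) / d ^ N * max \<bar>x - a\<bar> \<bar>y - b\<bar> ^ N"
    by (simp add: t_def power_divide)
qed

text \<open>For use along the solution curve: the faster the curve approaches the centre, the higher
  the order to which a fixed Taylor polynomial of f is accurate.\<close>

lemma power_series2_remainder_bigo:
  assumes "(u \<longlongrightarrow> a) F" "(v \<longlongrightarrow> b) F"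
    and u: "(\<lambda>r. u r - a) \<in> O[F](g)" and v: "(\<lambda>r. v r - b) \<in> O[F](g)"
  shows "(\<lambda>r. f (u r) (v r) - (\<Sum>i<N. \<Sum>j<N - i. c i j * (u r - a) ^ i * (v r - b) ^ j))
    \<in> O[F](\<lambda>r. g r ^ N)"
proof -
  obtain C where C: "\<And>x y. \<bar>x - a\<bar> \<le> e/2 \<Longrightarrow> \<bar>y - b\<bar> \<le> e/2 \<Longrightarrow>
    \<bar>f x y - (\<Sum>i<N. \<Sum>j<N - i. c i j * (x - a) ^ i * (y - b) ^ j)\<bar>
      \<le> C * max \<bar>x - a\<bar> \<bar>y - b\<bar> ^ N"
    using power_series2_remainder[where N = N] by blast
  have "\<forall>\<^sub>F r in F. \<bar>u r - a\<bar> < e/2" "\<forall>\<^sub>F r in F. \<bar>v r - b\<bar> < e/2"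
    using tendstoD[OF assms(1), of "e/2"] tendstoD[OF assms(2), of "e/2"] e
    by (simp_all add: dist_real_def)
  then have "\<forall>\<^sub>F r in F. norm (f (u r) (v r) - (\<Sum>i<N. \<Sum>j<N - i. c i j * (u r - a) ^ i * (v r - b) ^ j))
      \<le> C * norm (max \<bar>u r - a\<bar> \<bar>v r - b\<bar> ^ N)"
    by eventually_elim (use C in \<open>auto simp: power_abs\<close>)
  then have "(\<lambda>r. f (u r) (v r) - (\<Sum>i<N. \<Sum>j<N - i. c i j * (u r - a) ^ i * (v r - b) ^ j))
      \<in> O[F](\<lambda>r. max \<bar>u r - a\<bar> \<bar>v r - b\<bar> ^ N)"
    by (rule bigoI)
  also have "(\<lambda>r. max \<bar>u r - a\<bar> \<bar>v r - b\<bar>) \<in> O[F](\<lambda>r. \<bar>u r - a\<bar> + \<bar>v r - b\<bar>)"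
    by (intro bigoI[where c = 1] always_eventually) auto
  then have "(\<lambda>r. max \<bar>u r - a\<bar> \<bar>v r - b\<bar>) \<in> O[F](g)"
    by (rule landau_o.big_trans) (use u v in \<open>auto intro: sum_in_bigo\<close>)
  then have "(\<lambda>r. max \<bar>u r - a\<bar> \<bar>v r - b\<bar> ^ N) \<in> O[F](\<lambda>r. g r ^ N)"
    by (rule landau_o.big_power)
  finally show ?thesis .
qed

end

section \<open>Coefficient recursion from the TOV equation\<close>

lemma fps_mult_nth_upto5:
  fixes A B :: "real fps"
  shows "fps_nth (A * B) 1 = fps_nth A 0 * fps_nth B 1 + fps_nth A 1 * fps_nth B 0"
    "fps_nth (A * B) 2 = fps_nth A 0 * fps_nth B 2 + fps_nth A 1 * fps_nth B 1 + fps_nth A 2 * fps_nth B 0"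
    "fps_nth (A * B) 3 = fps_nth A 0 * fps_nth B 3 + fps_nth A 1 * fps_nth B 2
      + fps_nth A 2 * fps_nth B 1 + fps_nth A 3 * fps_nth B 0"
    "fps_nth (A * B) 4 = fps_nth A 0 * fps_nth B 4 + fps_nth A 1 * fps_nth B 3
      + fps_nth A 2 * fps_nth B 2 + fps_nth A 3 * fps_nth B 1 + fps_nth A 4 * fps_nth B 0"
    "fps_nth (A * B) 5 = fps_nth A 0 * fps_nth B 5 + fps_nth A 1 * fps_nth B 4
      + fps_nth A 2 * fps_nth B 3 + fps_nth A 3 * fps_nth B 2 + fps_nth A 4 * fps_nth B 1
      + fps_nth A 5 * fps_nth B 0"
  by (simp_all add: fps_mult_nth eval_nat_numeral)

text \<open>The TOV equation with \<open>2 M(r) = r\<^sup>3 Q(r)\<close> substituted, denominators cleared and a common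
  factor \<open>r\<close> cancelled.\<close>
definition tov_fps :: "real fps \<Rightarrow> real fps \<Rightarrow> real fps" where
  "tov_fps F P = fps_const 2 * ((1 - fps_X ^ 2 * fps_mean F) * fps_deriv P)
    + fps_X * ((F + P) * (P + fps_mean F))"

text \<open>The TOV equation is available only for r > 0, so \<open>h\<close> is known to vanish
  only on an interval to the right of 0. There it is O(r^(n+1)) for every n, which forces every
  coefficient of its series to be zero.\<close>

lemma tov_ode_fps:
  assumes tov: "tov_solution \<mu> p R" and e: "0 < e" "e \<le> R"
    and F: "ereal e \<le> fps_conv_radius F" "\<And>r. 0 \<le> r \<Longrightarrow> r < e \<Longrightarrow> eval_fps F r = \<mu> r"
    and P: "ereal e \<le> fps_conv_radius P" "\<And>r. 0 \<le> r \<Longrightarrow> r < e \<Longrightarrow> eval_fps P r = p r"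
  shows "fps_nth (tov_fps F P) n = 0"
proof -
  let ?m = "eval_fps F" and ?q = "eval_fps P" and ?Q = "eval_fps (fps_mean F)"
  define h where "h = (\<lambda>r. 2 * ((1 - r ^ 2 * ?Q r) * eval_fps (fps_deriv P) r) + r * ((?m r + ?q r) * (?q r + ?Q r)))"
  have rad: "fps_conv_radius F > 0" "fps_conv_radius P > 0"
    using e(1) F(1) P(1) by (auto intro: less_le_trans[of 0 "ereal e"])
  have "h has_fps_expansion tov_fps F P"
    unfolding h_def tov_fps_def
    by (intro has_fps_expansion_add has_fps_expansion_mult has_fps_expansion_diff has_fps_expansion_const
        has_fps_expansion_1 has_fps_expansion_fps_X has_fps_expansion_fps_X_power
        eval_fps_has_fps_expansion rad less_le_trans[OF rad(1) fps_conv_radius_mean]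
        less_le_trans[OF rad(2) fps_conv_radius_deriv])
  moreover have h0: "h r = 0" if r: "r \<in> {0<..<e}" for r
  proof -
    have mass: "2 * tov_mass \<mu> r = r ^ 3 * ?Q r"
      using tov_mass_eq_eval_fps[OF F] r by simp
    have *: "r > 2 * tov_mass \<mu> r"
      "(p has_real_derivative - (r\<^sup>2 * (\<mu> r + p r)) / (2 * (r - 2 * tov_mass \<mu> r)) * (p r + 2 * tov_mass \<mu> r / r ^ 3)) (at r)"
      using tov r e by (auto simp: tov_solution_def)
    have "r < fps_conv_radius P" using r by (intro less_le_trans[OF _ P(1)]) simp
    then have "(?q has_real_derivative eval_fps (fps_deriv P) r) (at r)"
      using r by (intro has_field_derivative_eval_fps) simp
    then have "(p has_real_derivative eval_fps (fps_deriv P) r) (at r)"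
      by (rule has_field_derivative_transform_within_open[where S = "{0<..<e}"]) (use r P(2) in auto)
    then have "eval_fps (fps_deriv P) r =
        - (r\<^sup>2 * (?m r + ?q r)) / (2 * (r - r ^ 3 * ?Q r)) * (?q r + r ^ 3 * ?Q r / r ^ 3)"
      using DERIV_unique[OF *(2)] r F(2) P(2) by (simp add: mass)
    \<comment> \<open>The denominator is nonzero because r > 2 M(r). Once it is cleared, one common
      factor r remains and is cancelled.\<close>
    moreover have "2 * (r - r ^ 3 * ?Q r) \<noteq> 0" using * mass by simp
    ultimately have "eval_fps (fps_deriv P) r * (2 * (r - r ^ 3 * ?Q r)) = - (r\<^sup>2 * (?m r + ?q r)) * (?q r + ?Q r)"
      using r by (simp del: mult_eq_0_iff right_diff_distrib_numeral)
    then have "r * h r = 0"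
      by (simp add: h_def algebra_simps power2_eq_square power3_eq_cube)
    then show ?thesis using r by simp
  qed
  have "\<forall>\<^sub>F r in at_right 0. h r = 0"
    using eventually_at_right_real[OF e(1)] by eventually_elim (rule h0)
  then have "h \<in> O[at_right 0](\<lambda>r. r ^ Suc n)"
    by (intro bigoI[where c = 0]) (auto elim: eventually_mono)
  ultimately show ?thesis
    using bigo_imp_fps_nth_eq_0 by blast
qed

text \<open>Coefficient n of \<open>tov_fps F P\<close> contains 2 (n + 1) times coefficient n + 1
  of \<open>P\<close>, plus terms in coefficients of lower index, so its first five coefficients
  determine \<open>P\<close> up to order 5 from \<open>F\<close>. At order 4 the second coefficient
  of \<open>F\<close> enters; the odd orders vanish by parity once the lower odd coefficients
  do.\<close>

lemma tov_fps_coeffs: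
  assumes "\<And>n. fps_nth (tov_fps F P) n = 0"
  defines "\<mu>c \<equiv> fps_nth F 0" and "pc \<equiv> fps_nth P 0"
  shows "fps_nth P 1 = 0"
    and "fps_nth P 2 = - (\<mu>c + pc) * (\<mu>c + 3 * pc) / 12"
    and "fps_nth F 1 = 0 \<Longrightarrow> fps_nth P 3 = 0"
    and "fps_nth F 1 = 0 \<Longrightarrow> fps_nth P 4 =
      ((\<mu>c + pc) * (\<mu>c + 3 * pc) * pc / 6 - 2 * fps_nth F 2 * (4 * \<mu>c + 9 * pc) / 15) / 8"
    and "fps_nth F 1 = 0 \<Longrightarrow> fps_nth F 3 = 0 \<Longrightarrow> fps_nth P 5 = 0"
proof -
  note coeff = tov_fps_def fps_mult_nth_upto5 fps_X_power_mult_nth fps_mean_def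
  have X: "fps_nth (fps_X * A) 1 = fps_nth A 0" "fps_nth (fps_X * A) 2 = fps_nth A 1"
    "fps_nth (fps_X * A) 3 = fps_nth A 2" "fps_nth (fps_X * A) 4 = fps_nth A 3" for A :: "real fps"
    by (simp_all add: eval_nat_numeral)
  show P1: "fps_nth P 1 = 0"
    using assms(1)[of 0] by (simp add: tov_fps_def)
  show P2: "fps_nth P 2 = - (\<mu>c + pc) * (\<mu>c + 3 * pc) / 12"
    using assms(1)[of 1] P1
    by (simp add: coeff X \<mu>c_def pc_def field_simps flip: numeral_2_eq_2)
  show P3: "fps_nth P 3 = 0" if "fps_nth F 1 = 0"
    using assms(1)[of 2] P1 that by (simp add: coeff X)
  show "fps_nth P 4 =
      ((\<mu>c + pc) * (\<mu>c + 3 * pc) * pc / 6 - 2 * fps_nth F 2 * (4 * \<mu>c + 9 * pc) / 15) / 8"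
    if "fps_nth F 1 = 0"
  proof -
    \<comment> \<open>Coefficient 3 of the equation, solved for the leading term. The quotients by 3
      and 5 are the coefficients 0 and 2 of \<open>fps_mean F\<close>.\<close>
    have "fps_nth P 4 = (4 * (\<mu>c / 3) * fps_nth P 2 - (\<mu>c + pc) * (fps_nth P 2 + fps_nth F 2 / 5)
        - (fps_nth F 2 + fps_nth P 2) * (pc + \<mu>c / 3)) / 8"
      using assms(1)[of 3] P1 that
      by (simp add: coeff X \<mu>c_def pc_def field_simps flip: numeral_2_eq_2)
    then show ?thesis
      unfolding P2 by (simp add: field_simps)
  qed
  show "fps_nth P 5 = 0" if "fps_nth F 1 = 0" "fps_nth F 3 = 0"
    using assms(1)[of 4] P1 P3 that by (simp add: coeff X)
qed

section \<open>Coefficient relations from the equation of state\<close>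

text \<open>The conclusions are staged because the later ones need vanishing that the TOV recursion
  supplies in between. Once the first-order coefficients vanish, quadratic terms start at order 4,
  so order 3 is linear; at order 5 each quadratic contribution contains a coefficient of index 3, so
  that order becomes linear too.\<close>

lemma eos_fps_nth_eq_0:
  fixes f :: "real \<Rightarrow> real \<Rightarrow> real" and k1 k2 k11 k12 k22 :: real
  defines "L \<equiv> \<lambda>u v. k1 * u + k2 * v" and "S \<equiv> \<lambda>u v. k11 / 2 * u ^ 2 + k12 * u * v + k22 / 2 * v ^ 2"
  assumes f: "real_analytic2_at f (fps_nth F 0) (fps_nth P 0)"
    and k: "k1 = partial1 f (fps_nth F 0) (fps_nth P 0)" "k2 = partial2 f (fps_nth F 0) (fps_nth P 0)"
      "k11 = partial1 (partial1 f) (fps_nth F 0) (fps_nth P 0)"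
      "k12 = partial2 (partial1 f) (fps_nth F 0) (fps_nth P 0)"
      "k22 = partial2 (partial2 f) (fps_nth F 0) (fps_nth P 0)"
    and rad: "fps_conv_radius F > 0" "fps_conv_radius P > 0"
    and center: "f (fps_nth F 0) (fps_nth P 0) = 0"
    and eos: "\<forall>\<^sub>F r in at_right 0. f (eval_fps F r) (eval_fps P r) = 0"
  shows "k1 * fps_nth F 1 + k2 * fps_nth P 1 = 0"
    and "fps_nth F 1 = 0 \<Longrightarrow> fps_nth P 1 = 0 \<Longrightarrow> k1 * fps_nth F 3 + k2 * fps_nth P 3 = 0"
    and "fps_nth F 1 = 0 \<Longrightarrow> fps_nth P 1 = 0 \<Longrightarrow>
      k1 * fps_nth F 2 + k2 * fps_nth P 2 = 0 \<and>
      k1 * fps_nth F 4 + k2 * fps_nth P 4 + S (fps_nth F 2) (fps_nth P 2) = 0"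
    and "fps_nth F 1 = 0 \<Longrightarrow> fps_nth P 1 = 0 \<Longrightarrow> fps_nth F 3 = 0 \<Longrightarrow> fps_nth P 3 = 0 \<Longrightarrow>
      k1 * fps_nth F 5 + k2 * fps_nth P 5 = 0"
proof -
  define a b where "a = fps_nth F 0" and "b = fps_nth P 0"
  obtain c e where e: "e > 0" and c: "\<And>x y. \<bar>x - a\<bar> < e \<Longrightarrow> \<bar>y - b\<bar> < e \<Longrightarrow>
      ((\<lambda>(i, j). c i j * (x - a) ^ i * (y - b) ^ j) has_sum f x y) UNIV"
    using f unfolding real_analytic2_at_def a_def b_def by auto
  have c_eq: "c 0 0 = 0" "c 1 0 = k1" "c 0 1 = k2" "c 2 0 = k11 / 2" "c 1 1 = k12" "c 0 2 = k22 / 2"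
    using power_series2_center[OF e c] power_series2_partials[OF e c] center
    by (simp_all add: k a_def b_def)
  define U V where "U = F - fps_const a" and "V = P - fps_const b"
  define u v where "u = (\<lambda>r. eval_fps F r - a)" and "v = (\<lambda>r. eval_fps P r - b)"
  have uv: "u has_fps_expansion U" "v has_fps_expansion V"
    unfolding u_def v_def U_def V_def
    by (intro has_fps_expansion_diff has_fps_expansion_const eval_fps_has_fps_expansion rad)+
  have UV: "fps_nth U 0 = 0" "fps_nth V 0 = 0"
    "n > 0 \<Longrightarrow> fps_nth U n = fps_nth F n" "n > 0 \<Longrightarrow> fps_nth V n = fps_nth P n" for n
    by (simp_all add: U_def V_def a_def b_def)
  have lim: "(eval_fps F \<longlongrightarrow> a) (at_right 0)" "(eval_fps P \<longlongrightarrow> b) (at_right 0)"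
    unfolding a_def b_def by (intro has_fps_expansion_tendsto eval_fps_has_fps_expansion rad)+
  \<comment> \<open>Since f vanishes along the solution, its Taylor polynomial there is minus the
    remainder and inherits the order of the remainder.\<close>
  have taylor: "(\<lambda>r. \<Sum>i<N. \<Sum>j<N - i. c i j * u r ^ i * v r ^ j) \<in> O[at_right 0](\<lambda>r. (r ^ k) ^ N)"
    if "\<And>n. n < k \<Longrightarrow> fps_nth U n = 0" "\<And>n. n < k \<Longrightarrow> fps_nth V n = 0" for k N
  proof -
    have uv': "(\<lambda>r. eval_fps F r - a) \<in> O[at_right 0](\<lambda>r. r ^ k)"
        "(\<lambda>r. eval_fps P r - b) \<in> O[at_right 0](\<lambda>r. r ^ k)"
      using fps_expansion_imp_bigo[OF uv(1) that(1)] fps_expansion_imp_bigo[OF uv(2) that(2)]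
      by (simp_all add: u_def v_def)
    have ev: "\<forall>\<^sub>F r in at_right 0. f (eval_fps F r) (eval_fps P r)
        - (\<Sum>i<N. \<Sum>j<N - i. c i j * (eval_fps F r - a) ^ i * (eval_fps P r - b) ^ j)
        = - (\<Sum>i<N. \<Sum>j<N - i. c i j * u r ^ i * v r ^ j)"
      using eos by eventually_elim (simp add: u_def v_def)
    show ?thesis
      using power_series2_remainder_bigo[OF e c lim uv', where N = N]
      unfolding landau_o.big.in_cong[OF ev] by simp
  qed
  \<comment> \<open>The deviations vanish at 0, so k = 1 is available; total degree below 2 is the
    linear part, accurate to O(r^2), which reaches coefficient 1.\<close>
  have small: "\<And>n. n < 1 \<Longrightarrow> fps_nth U n = 0" "\<And>n. n < 1 \<Longrightarrow> fps_nth V n = 0" by (simp_all add: UV)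
  have "(\<lambda>r. \<Sum>i<2. \<Sum>j<2 - i. c i j * u r ^ i * v r ^ j) = (\<lambda>r. L (u r) (v r))"
    using c_eq by (simp add: eval_nat_numeral L_def add.commute)
  then have "(\<lambda>r. L (u r) (v r)) \<in> O[at_right 0](\<lambda>r. r ^ 2)"
    using taylor[of 1 2, OF small] by simp
  moreover have "(\<lambda>r. L (u r) (v r)) has_fps_expansion (fps_const k1 * U + fps_const k2 * V)"
    unfolding L_def by (intro has_fps_expansion_add has_fps_expansion_cmult_left uv)
  ultimately have "fps_nth (fps_const k1 * U + fps_const k2 * V) 1 = 0"
    by (intro bigo_imp_fps_nth_eq_0[where N = 2]) auto
  then show "k1 * fps_nth F 1 + k2 * fps_nth P 1 = 0"
    by (simp add: UV)
  assume "fps_nth F 1 = 0" "fps_nth P 1 = 0"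
  then have UV1: "fps_nth U 1 = 0" "fps_nth V 1 = 0" by (simp_all add: UV)
  \<comment> \<open>With k = 2, total degree below 3 is accurate to O(r^6), so one comparison covers
    all coefficients up to index 5.\<close>
  then have small: "\<And>n. n < 2 \<Longrightarrow> fps_nth U n = 0" "\<And>n. n < 2 \<Longrightarrow> fps_nth V n = 0"
    using UV(1,2) by (auto simp: less_2_cases_iff)
  have "(\<lambda>r. \<Sum>i<3. \<Sum>j<3 - i. c i j * u r ^ i * v r ^ j) = (\<lambda>r. L (u r) (v r) + S (u r) (v r))"
  proof -
    have sum3: "(\<Sum>i<3. \<Sum>j<3 - i. c i j * x ^ i * y ^ j) = c 0 0 + c 0 1 * y + c 0 2 * y ^ 2
        + c 1 0 * x + c 1 1 * x * y + c 2 0 * x ^ 2" for x y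
      by (simp add: eval_nat_numeral)
    show ?thesis unfolding sum3 c_eq by (simp add: L_def S_def algebra_simps)
  qed
  then have "(\<lambda>r. L (u r) (v r) + S (u r) (v r)) \<in> O[at_right 0](\<lambda>r. r ^ 6)"
    using taylor[of 2 3, OF small] by (simp flip: power_mult)
  moreover define E where "E = fps_const k1 * U + fps_const k2 * V
      + (fps_const (k11 / 2) * (U * U) + fps_const k12 * (U * V) + fps_const (k22 / 2) * (V * V))"
  have "(\<lambda>r. L (u r) (v r) + S (u r) (v r)) has_fps_expansion E"
    unfolding L_def S_def E_def power2_eq_square mult.assoc
    by (intro has_fps_expansion_add has_fps_expansion_cmult_left has_fps_expansion_mult uv)
  ultimately have E: "fps_nth E n = 0" if "n < 6" for n
    using bigo_imp_fps_nth_eq_0 that by blast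
  show "k1 * fps_nth F 3 + k2 * fps_nth P 3 = 0"
    using E[of 3] UV1 by (simp add: E_def fps_mult_nth_upto5 UV)
  show "k1 * fps_nth F 2 + k2 * fps_nth P 2 = 0 \<and>
      k1 * fps_nth F 4 + k2 * fps_nth P 4 + S (fps_nth F 2) (fps_nth P 2) = 0"
    using E[of 2] E[of 4] UV1 by (simp add: E_def fps_mult_nth_upto5 UV S_def power2_eq_square)
  assume "fps_nth F 3 = 0" "fps_nth P 3 = 0"
  then show "k1 * fps_nth F 5 + k2 * fps_nth P 5 = 0"
    using E[of 5] UV1 by (simp add: E_def fps_mult_nth_upto5 UV)
qed

section \<open>Expansion of \<open>tov_A\<close> and Taylor bounds for the even profiles\<close>

text \<open>Substituting 2M = r^3 Q turns \<open>tov_A\<close> into r (p + Q) / (2 sqrt (1 - u))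
  with u = r^2 Q = 2M/r. Splitting 1 / sqrt (1 - u) into 1 + u/2 and an error of order u^2 leaves a
  part \<open>B\<close> with an explicit series and a part \<open>D\<close> of order r^5.\<close>

lemma tov_A_bigo:
  assumes F: "0 < e" "ereal e \<le> fps_conv_radius F" "\<And>r. 0 \<le> r \<Longrightarrow> r < e \<Longrightarrow> eval_fps F r = \<mu> r"
    and P: "fps_conv_radius P > 0" "\<And>r. 0 \<le> r \<Longrightarrow> r < e \<Longrightarrow> eval_fps P r = p r"
    and odd: "fps_nth F 1 = 0" "fps_nth P 1 = 0" "fps_nth F 3 = 0" "fps_nth P 3 = 0"
  shows "(\<lambda>r. tov_A \<mu> p r - ((fps_nth F 0 + 3 * fps_nth P 0) / 6 * r
      + ((fps_nth P 2 + fps_nth F 2 / 5) / 2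
        + (fps_nth F 0 + 3 * fps_nth P 0) * fps_nth F 0 / 36) * r ^ 3)) \<in> O[at_right 0](\<lambda>r. r ^ 5)"
proof -
  let ?Q = "eval_fps (fps_mean F)" and ?q = "eval_fps P"
  define u where "u = (\<lambda>r. r ^ 2 * ?Q r)"
  define B where "B = (\<lambda>r. r * (1/2 * ((?q r + ?Q r) * (1 + 1/2 * u r))))"
  define D where "D = (\<lambda>r. r * (1/2 * ((?q r + ?Q r) * (1 / sqrt (1 - u r) - (1 + u r / 2)))))"
  have rad: "fps_conv_radius (fps_mean F) > 0"
    using F(1,2) fps_conv_radius_mean[of F] by (auto intro: less_le_trans[of 0 "ereal e"] order_trans)
  note exp = eval_fps_has_fps_expansion[OF P(1)] eval_fps_has_fps_expansion[OF rad]
  have u: "u has_fps_expansion fps_X ^ 2 * fps_mean F"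
    unfolding u_def by (intro has_fps_expansion_mult has_fps_expansion_fps_X_power exp)
  define H where "H = fps_X * (fps_const (1/2) * ((P + fps_mean F) * (1 + fps_const (1/2) * (fps_X ^ 2 * fps_mean F))))"
  have "B has_fps_expansion H"
    unfolding B_def H_def by (intro has_fps_expansion_mult has_fps_expansion_add has_fps_expansion_fps_X
        has_fps_expansion_1 has_fps_expansion_cmult_left exp u)
  from fps_expansion_taylor_bigo[OF this, of 5]
  have T: "(\<lambda>r. B r - (\<Sum>n<5. fps_nth H n * r ^ n)) \<in> O[at_right 0](\<lambda>r. r ^ 5)" .
  \<comment> \<open>The prefactor r shifts parity: the coefficients 2 and 4 of \<open>H\<close> come
    from odd coefficients of \<open>P\<close> and \<open>fps_mean F\<close>, which vanish by
    \<open>odd\<close>. The second summand of the cubic coefficient is the linear one times the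
    leading coefficient of u/2.\<close>
  have H: "fps_nth H 0 = 0" "fps_nth H 1 = (fps_nth F 0 + 3 * fps_nth P 0) / 6"
      "fps_nth H 2 = 0" "fps_nth H 4 = 0"
      "fps_nth H 3 = (fps_nth P 2 + fps_nth F 2 / 5) / 2 + (fps_nth F 0 + 3 * fps_nth P 0) * fps_nth F 0 / 36"
    using odd
    by (simp_all add: H_def fps_mult_nth_upto5 fps_X_power_mult_nth fps_mean_def field_simps
        flip: numeral_2_eq_2 numeral_3_eq_3)
  have sum: "(\<Sum>n<5. fps_nth H n * r ^ n) = fps_nth H 0 + fps_nth H 1 * r + fps_nth H 2 * r ^ 2
      + fps_nth H 3 * r ^ 3 + fps_nth H 4 * r ^ 4" for r
    by (simp add: eval_nat_numeral)
  have B: "(\<lambda>r. B r - ((fps_nth F 0 + 3 * fps_nth P 0) / 6 * r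
      + ((fps_nth P 2 + fps_nth F 2 / 5) / 2
        + (fps_nth F 0 + 3 * fps_nth P 0) * fps_nth F 0 / 36) * r ^ 3)) \<in> O[at_right 0](\<lambda>r. r ^ 5)"
    using T unfolding sum H by simp
  have "(u \<longlongrightarrow> 0) (at_right 0)"
    using has_fps_expansion_tendsto[OF u] by simp
  then have "\<forall>\<^sub>F r in at_right 0. \<bar>u r\<bar> < 3/4"
    using tendstoD[of u 0 "at_right 0" "3/4"] by simp
  then have "\<forall>\<^sub>F r in at_right 0. norm (1 / sqrt (1 - u r) - (1 + u r / 2)) \<le> 4 * norm ((u r)\<^sup>2)"
    by eventually_elim (use inverse_sqrt_remainder in simp)
  then have "(\<lambda>r. 1 / sqrt (1 - u r) - (1 + u r / 2)) \<in> O[at_right 0](\<lambda>r. (u r)\<^sup>2)"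
    by (rule bigoI)
  also have "u \<in> O[at_right 0](\<lambda>r. r ^ 2)"
    by (rule fps_expansion_imp_bigo[OF u]) (simp add: fps_X_power_mult_nth)
  then have "(\<lambda>r. (u r)\<^sup>2) \<in> O[at_right 0](\<lambda>r. (r ^ 2)\<^sup>2)"
    by (rule landau_o.big_power)
  finally have S: "(\<lambda>r. 1 / sqrt (1 - u r) - (1 + u r / 2)) \<in> O[at_right 0](\<lambda>r. r ^ 4)"
    by (simp flip: power_mult)
  have "(\<lambda>r. 1/2 * (?q r + ?Q r)) \<in> O[at_right 0](\<lambda>r. r ^ 0)"
    by (rule fps_expansion_imp_bigo[OF has_fps_expansion_cmult_left[OF has_fps_expansion_add[OF exp]]]) simp
  then have "(\<lambda>r. r * (1/2 * (?q r + ?Q r) * (1 / sqrt (1 - u r) - (1 + u r / 2))))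
      \<in> O[at_right 0](\<lambda>r. r * (r ^ 0 * r ^ 4))"
    by (intro landau_o.big.mult S landau_o.big_refl)
  then have D: "D \<in> O[at_right 0](\<lambda>r. r ^ 5)"
    by (simp add: D_def mult.assoc eval_nat_numeral)
  have "tov_A \<mu> p r = B r + D r" if "r \<in> {0<..<e}" for r
  proof -
    have M: "2 * tov_mass \<mu> r = r ^ 3 * ?Q r"
      using tov_mass_eq_eval_fps[OF F(2,3)] that by simp
    have "tov_A \<mu> p r = r * (1/2 * ((?q r + ?Q r) * (1 / sqrt (1 - u r))))"
      using that P(2)[of r] unfolding tov_A_def tov_phi_def M u_def
      by (simp add: power3_eq_cube power2_eq_square mult_ac)
    then show ?thesis by (simp add: B_def D_def algebra_simps)
  qed
  then have "\<forall>\<^sub>F r in at_right 0. tov_A \<mu> p r - X r = (B r - X r) + D r" for X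
    using eventually_at_right_real[OF F(1)] by (auto elim: eventually_mono)
  then show ?thesis
    using sum_in_bigo(1)[OF B D] by (subst landau_o.big.in_cong) assumption+
qed

lemma even_taylor_bigo:
  assumes F: "0 < e" "ereal e \<le> fps_conv_radius F" "\<And>r. 0 \<le> r \<Longrightarrow> r < e \<Longrightarrow> eval_fps F r = g r"
    and odd: "fps_nth F 1 = 0" "fps_nth F 3 = 0" "fps_nth F 5 = 0"
  shows "(\<lambda>r. g r - (fps_nth F 0 + fps_nth F 2 * r ^ 2 + fps_nth F 4 * r ^ 4)) \<in> O[at_right 0](\<lambda>r. r ^ 6)"
proof -
  have "fps_conv_radius F > 0"
    using F(1,2) by (auto intro: less_le_trans[of 0 "ereal e"])
  then have T: "(\<lambda>r. eval_fps F r - (\<Sum>n<6. fps_nth F n * r ^ n)) \<in> O[at_right 0](\<lambda>r. r ^ 6)"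
    by (intro fps_expansion_taylor_bigo eval_fps_has_fps_expansion)
  have sum: "(\<Sum>n<6. fps_nth F n * r ^ n) = fps_nth F 0 + fps_nth F 1 * r + fps_nth F 2 * r ^ 2
      + fps_nth F 3 * r ^ 3 + fps_nth F 4 * r ^ 4 + fps_nth F 5 * r ^ 5" for r
    by (simp add: eval_nat_numeral)
  have ev: "\<forall>\<^sub>F r in at_right 0. eval_fps F r - (\<Sum>n<6. fps_nth F n * r ^ n)
      = g r - (fps_nth F 0 + fps_nth F 2 * r ^ 2 + fps_nth F 4 * r ^ 4)"
    using eventually_at_right_real[OF F(1)] by eventually_elim (simp add: sum odd[unfolded One_nat_def] F(3))
  show ?thesis
    using T unfolding landau_o.big.in_cong[OF ev] .
qed

section \<open>Solving for the coefficients and assembling the expansions\<close>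

theorem mainTheorem5:
  fixes f :: "real \<Rightarrow> real \<Rightarrow> real" and \<mu> p :: "real \<Rightarrow> real"
    and R \<mu>c pc f\<mu> fp f\<mu>\<mu> f\<mu>p fpp :: real
  assumes central: "\<mu>c = \<mu> 0" "pc = p 0"
    and f_analytic: "real_analytic2_at f \<mu>c pc"
    and first_partials: "f\<mu> = partial1 f \<mu>c pc" "fp = partial2 f \<mu>c pc"
    and second_partials: "f\<mu>\<mu> = partial1 (partial1 f) \<mu>c pc"
      "f\<mu>p = partial2 (partial1 f) \<mu>c pc" "fpp = partial2 (partial2 f) \<mu>c pc"
    and nondegenerate: "f\<mu> \<noteq> 0"
    and analytic: "real_analytic_at_within \<mu> 0 {0..}" "real_analytic_at_within p 0 {0..}"
    and tov: "tov_solution \<mu> p R"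
    and eos: "\<And>r. 0 \<le> r \<Longrightarrow> r < R \<Longrightarrow> f (\<mu> r) (p r) = 0"
  shows "(\<lambda>r. \<mu> r -
            (\<mu>c + (\<mu>c + pc) * (\<mu>c + 3 * pc) * fp / (12 * f\<mu>) * r ^ 2
              + (\<mu>c\<^sup>2 + 3 * pc\<^sup>2 + 4 * \<mu>c * pc) / (48 * f\<mu>) *
                ((4 * \<mu>c + 9 * pc) * fp\<^sup>2 / (15 * f\<mu>)
                 - (\<mu>c + pc) * (\<mu>c + 3 * pc) * fpp / 6
                 + (\<mu>c + pc) * (\<mu>c + 3 * pc) * fp * f\<mu>p / (3 * f\<mu>)
                 - (\<mu>c + pc) * (\<mu>c + 3 * pc) * fp\<^sup>2 * f\<mu>\<mu> / (6 * f\<mu>\<^sup>2)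
                 - pc * fp) * r ^ 4))
          \<in> O[at_right 0](\<lambda>r. r ^ 6)
       \<and> (\<lambda>r. p r -
            (pc - (\<mu>c + pc) * (\<mu>c + 3 * pc) / 12 * r ^ 2
              - (\<mu>c + pc) * (\<mu>c + 3 * pc) * ((4 * \<mu>c + 9 * pc) * fp - 15 * pc * f\<mu>)
                / (720 * f\<mu>) * r ^ 4))
          \<in> O[at_right 0](\<lambda>r. r ^ 6)
       \<and> (\<lambda>r. tov_A \<mu> p r -
            ((\<mu>c + 3 * pc) / 6 * r
              + (\<mu>c + 3 * pc) * (3 * (\<mu>c + pc) * fp - 5 * (\<mu>c + 3 * pc) * f\<mu>)
                / (360 * f\<mu>) * r ^ 3))
          \<in> O[at_right 0](\<lambda>r. r ^ 5)"
proof -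
  obtain F e1 where F: "e1 > 0" "ereal e1 \<le> fps_conv_radius F" "\<And>r. 0 \<le> r \<Longrightarrow> r < e1 \<Longrightarrow> eval_fps F r = \<mu> r"
    using real_analytic_at_within_0_fps[OF analytic(1)] by blast
  obtain P e2 where P: "e2 > 0" "ereal e2 \<le> fps_conv_radius P" "\<And>r. 0 \<le> r \<Longrightarrow> r < e2 \<Longrightarrow> eval_fps P r = p r"
    using real_analytic_at_within_0_fps[OF analytic(2)] by blast
  have R: "R > 0" using tov by (simp add: tov_solution_def)
  \<comment> \<open>Below this common radius both series represent their profiles, and the TOV
    equation and the equation of state are available.\<close>
  define e where "e = min R (min e1 e2)"
  have e: "0 < e" "e \<le> R" "e \<le> e1" "e \<le> e2"
    using R F(1) P(1) by (auto simp: e_def)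
  have e: "0 < e" "e \<le> R" "ereal e \<le> fps_conv_radius F" "ereal e \<le> fps_conv_radius P"
    using e order_trans[OF _ F(2), of "ereal e"] order_trans[OF _ P(2), of "ereal e"] by simp_all
  have ev: "\<And>r. 0 \<le> r \<Longrightarrow> r < e \<Longrightarrow> eval_fps F r = \<mu> r" "\<And>r. 0 \<le> r \<Longrightarrow> r < e \<Longrightarrow> eval_fps P r = p r"
    using F(3) P(3) by (auto simp: e_def)
  have rad: "fps_conv_radius F > 0" "fps_conv_radius P > 0"
    using e by (auto intro: less_le_trans[of 0 "ereal e"])
  \<comment> \<open>The agreement \<open>ev\<close> includes r = 0, which identifies the constant
    coefficients with the central values.\<close>
  have c: "fps_nth F 0 = \<mu>c" "fps_nth P 0 = pc"
    using ev[of 0] e(1) by (simp_all add: central eval_fps_at_0)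
  have "fps_nth (tov_fps F P) n = 0" for n
    by (rule tov_ode_fps[OF tov e(1,2,3) ev(1) e(4) ev(2)])
  note ode = tov_fps_coeffs[OF this, unfolded c]
  have f0: "f (fps_nth F 0) (fps_nth P 0) = 0"
    using eos[of 0] R by (simp add: c central)
  have "\<forall>\<^sub>F r in at_right 0. f (eval_fps F r) (eval_fps P r) = 0"
    using eventually_at_right_real[OF e(1)] by eventually_elim (use ev e(2) eos in auto)
  note eos_fps = eos_fps_nth_eq_0[OF _ _ _ _ _ _ rad f0 this, unfolded c,
      OF f_analytic first_partials second_partials]
  \<comment> \<open>The odd orders vanish alternately: a zero of \<open>P\<close> from the TOV
    recursion makes the relation from the equation of state homogeneous,
    \<open>nondegenerate\<close> then gives the zero of \<open>F\<close>, and this releases the next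
    odd order of \<open>P\<close>.\<close>
  have P1: "fps_nth P 1 = 0" by (rule ode(1))
  have F1: "fps_nth F 1 = 0" using eos_fps(1) P1 nondegenerate by simp
  have P3: "fps_nth P 3 = 0" by (rule ode(3)[OF F1])
  have F3: "fps_nth F 3 = 0" using eos_fps(2)[OF F1 P1] P3 nondegenerate by simp
  have P5: "fps_nth P 5 = 0" by (rule ode(5)[OF F1 F3])
  have F5: "fps_nth F 5 = 0" using eos_fps(4)[OF F1 P1 F3 P3] P5 nondegenerate by simp
  have P2: "fps_nth P 2 = - (\<mu>c + pc) * (\<mu>c + 3 * pc) / 12" by (rule ode(2))
  have F2: "fps_nth F 2 = (\<mu>c + pc) * (\<mu>c + 3 * pc) * fp / (12 * f\<mu>)"
    using eos_fps(3)[OF F1 P1] nondegenerate by (simp add: P2 field_simps)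
  have P4: "fps_nth P 4 = - ((\<mu>c + pc) * (\<mu>c + 3 * pc) * ((4 * \<mu>c + 9 * pc) * fp - 15 * pc * f\<mu>)
      / (720 * f\<mu>))"
    using nondegenerate by (simp add: ode(4)[OF F1] F2 field_simps)
  \<comment> \<open>Order 4 is where the second derivatives of f first contribute, through products
    of second-order coefficients.\<close>
  have "fps_nth F 4 = - (fp * fps_nth P 4 + (f\<mu>\<mu> / 2 * fps_nth F 2 ^ 2
      + f\<mu>p * fps_nth F 2 * fps_nth P 2 + fpp / 2 * fps_nth P 2 ^ 2)) / f\<mu>"
    using eos_fps(3)[OF F1 P1] nondegenerate by (simp add: field_simps)
  also have "\<dots> = (\<mu>c\<^sup>2 + 3 * pc\<^sup>2 + 4 * \<mu>c * pc) / (48 * f\<mu>) *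
                ((4 * \<mu>c + 9 * pc) * fp\<^sup>2 / (15 * f\<mu>)
                 - (\<mu>c + pc) * (\<mu>c + 3 * pc) * fpp / 6
                 + (\<mu>c + pc) * (\<mu>c + 3 * pc) * fp * f\<mu>p / (3 * f\<mu>)
                 - (\<mu>c + pc) * (\<mu>c + 3 * pc) * fp\<^sup>2 * f\<mu>\<mu> / (6 * f\<mu>\<^sup>2)
                 - pc * fp)"
  proof -
    \<comment> \<open>The prefactor in the claim is an expanded product that \<open>P2\<close>,
      \<open>F2\<close> and \<open>P4\<close> all carry, so the claim becomes an identity with
      \<open>w\<close> as a single unknown.\<close>
    have st: "\<mu>c\<^sup>2 + 3 * pc\<^sup>2 + 4 * \<mu>c * pc = (\<mu>c + pc) * (\<mu>c + 3 * pc)"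
      by (simp add: power2_eq_square algebra_simps)
    define w where "w = (\<mu>c + pc) * (\<mu>c + 3 * pc)"
    show ?thesis
      unfolding P4 F2 P2 st minus_mult_left[symmetric] w_def[symmetric] using nondegenerate
      by (simp add: field_simps power2_eq_square)
  qed
  finally have F4: "fps_nth F 4 = \<dots>" .
  \<comment> \<open>In the part free of \<open>fp\<close>, 2 \<mu>c - 3 (\<mu>c + pc) = - (\<mu>c +
    3 pc); this produces the square of \<mu>c + 3 pc.\<close>
  have A3: "(fps_nth P 2 + fps_nth F 2 / 5) / 2 + (\<mu>c + 3 * pc) * \<mu>c / 36
      = (\<mu>c + 3 * pc) * (3 * (\<mu>c + pc) * fp - 5 * (\<mu>c + 3 * pc) * f\<mu>) / (360 * f\<mu>)"
    using nondegenerate by (simp add: P2 F2 field_simps)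
  show ?thesis
  proof (intro conjI)
    show "(\<lambda>r. tov_A \<mu> p r -
            ((\<mu>c + 3 * pc) / 6 * r
              + (\<mu>c + 3 * pc) * (3 * (\<mu>c + pc) * fp - 5 * (\<mu>c + 3 * pc) * f\<mu>)
                / (360 * f\<mu>) * r ^ 3))
          \<in> O[at_right 0](\<lambda>r. r ^ 5)"
      using tov_A_bigo[OF e(1,3) ev(1) rad(2) ev(2) F1 P1 F3 P3] unfolding c A3 .
    show "(\<lambda>r. p r -
            (pc - (\<mu>c + pc) * (\<mu>c + 3 * pc) / 12 * r ^ 2
              - (\<mu>c + pc) * (\<mu>c + 3 * pc) * ((4 * \<mu>c + 9 * pc) * fp - 15 * pc * f\<mu>)
                / (720 * f\<mu>) * r ^ 4))
          \<in> O[at_right 0](\<lambda>r. r ^ 6)"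
      using even_taylor_bigo[OF e(1,4) ev(2) P1 P3 P5] unfolding c P2 P4
      by (simp only: minus_mult_left[symmetric] minus_divide_left[symmetric] add_uminus_conv_diff)
  qed (use even_taylor_bigo[OF e(1,3) ev(1) F1 F3 F5] in \<open>unfold c F2 F4\<close>)
qed

end
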